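(* There exist constants $c,C>0$ such that for all sufficiently large $n$ and all $r\ge 0$, $0<\epsilon\le1$ and $R$ with $\epsilon<R$ and $c\sqrt{\log n}\le R\le\sqrt n$, with probability at least $1-1/n$ the flooding time of the stationary geometric-MEG $\mathcal{G}(n,r,R,\epsilon)$ is at most $C\left(\frac{\sqrt n}{R}+\log\log R\right)$.
   Context: $L_{n,\epsilon}=\{(i\epsilon,j\epsilon): i,j\in\mathbb{N},\ i,j\le\sqrt n/\epsilon\}$; $\Gamma(\mathbf{x})=\{\mathbf{y}\in L_{n,\epsilon}:d(\mathbf{x},\mathbf{y})\le r\}$ with $d$ Euclidean distance. Each node $i\in[n]$ has position $P_{i,t}\in L_{n,\epsilon}$ evolving independently as a Markov chain that moves from $\mathbf{x}$ to a uniform random point of $\Gamma(\mathbf{x})$. The geometric-MEG $\mathcal{G}(n,r,R,\epsilon)=\{G_t\}$ has $G_t=([n],E_t)$, $E_t=\{\{i,j\}: d(P_{i,t},P_{j,t})\le R\}$. It is stationary when the initial positions are independent with law $\pi(\mathbf{x})=|\Gamma(\mathbf{x})|/\sum_{\mathbf{y}}|\Gamma(\mathbf{y})|$. Flooding from source $s$: $I_0=\{s\}$, $I_{t+1}=I_t\cup N_t(I_t)$, where $N_t(I)$ is the set of nodes outside $I$ adjacent in $G_t$ to a node of $I$; $T(s)$ is the first $t$ with $I_t=[n]$, and the flooding time is $\max_s T(s)$. *)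

theory Defs
  imports "HOL-Probability.Probability"
begin

type_synonym point = "real \<times> real"
(* dist on real \<times> real is Euclidean: dist (a,b) (c,d) = sqrt ((a-c)^2 + (b-d)^2) *)

definition lattice :: "nat \<Rightarrow> real \<Rightarrow> point set" where
  "lattice n \<epsilon> = {(real i * \<epsilon>, real j * \<epsilon>) | i j :: nat.
      real i \<le> sqrt (real n) / \<epsilon> \<and> real j \<le> sqrt (real n) / \<epsilon>}"

definition nbhd :: "nat \<Rightarrow> real \<Rightarrow> real \<Rightarrow> point \<Rightarrow> point set" where
  "nbhd n \<epsilon> r x = {y \<in> lattice n \<epsilon>. dist x y \<le> r}"

definition move_pmf :: "nat \<Rightarrow> real \<Rightarrow> real \<Rightarrow> point \<Rightarrow> point pmf" where
  "move_pmf n \<epsilon> r x = pmf_of_set (nbhd n \<epsilon> r x)"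

definition stat_pmf :: "nat \<Rightarrow> real \<Rightarrow> real \<Rightarrow> point pmf" where
  "stat_pmf n \<epsilon> r = embed_pmf (\<lambda>x. if x \<in> lattice n \<epsilon>
      then real (card (nbhd n \<epsilon> r x)) / (\<Sum>y\<in>lattice n \<epsilon>. real (card (nbhd n \<epsilon> r y)))
      else 0)"

(* law of a Markov chain with kernel K and initial law mu, at times 0..T;
   the trajectory is frozen (constant) after time T *)
primrec walk_pmf :: "('a \<Rightarrow> 'a pmf) \<Rightarrow> 'a pmf \<Rightarrow> nat \<Rightarrow> (nat \<Rightarrow> 'a) pmf" where
  "walk_pmf K \<mu> 0 = map_pmf (\<lambda>x. \<lambda>_. x) \<mu>"
| "walk_pmf K \<mu> (Suc T) = bind_pmf (walk_pmf K \<mu> T)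
     (\<lambda>w. map_pmf (\<lambda>y. \<lambda>t. if t \<le> T then w t else y) (K (w T)))"

(* stationary geometric-MEG G(n,r,R,eps) observed up to time H:
   P i t = position of node i at time t; nodes move independently *)
definition meg_pmf :: "nat \<Rightarrow> real \<Rightarrow> real \<Rightarrow> nat \<Rightarrow> (nat \<Rightarrow> nat \<Rightarrow> point) pmf" where
  "meg_pmf n r \<epsilon> H = Pi_pmf {..<n} undefined
      (\<lambda>i. walk_pmf (move_pmf n \<epsilon> r) (stat_pmf n \<epsilon> r) H)"

primrec informed :: "nat \<Rightarrow> real \<Rightarrow> (nat \<Rightarrow> nat \<Rightarrow> point) \<Rightarrow> nat \<Rightarrow> nat \<Rightarrow> nat set" where
  "informed n R P s 0 = {s}"
| "informed n R P s (Suc t) = informed n R P s t \<union>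
     {j \<in> {..<n} - informed n R P s t. \<exists>i \<in> informed n R P s t. dist (P i t) (P j t) \<le> R}"

definition flood_from :: "nat \<Rightarrow> real \<Rightarrow> (nat \<Rightarrow> nat \<Rightarrow> point) \<Rightarrow> nat \<Rightarrow> enat" where
  "flood_from n R P s = (if \<exists>t. informed n R P s t = {..<n}
      then enat (LEAST t. informed n R P s t = {..<n}) else \<infinity>)"

definition flooding_time :: "nat \<Rightarrow> real \<Rightarrow> (nat \<Rightarrow> nat \<Rightarrow> point) \<Rightarrow> enat" where
  "flooding_time n R P = Max (flood_from n R P ` {..<n})"

end

theory Submission
  imports Defs
begin

text \<open>
  Cut the square into \<open>K \<times> K\<close> cells, \<open>K = \<Theta>(sqrt n / R)\<close>, so small that nodes in the same cell or in
  cells sharing a side are within distance \<open>R\<close>. The stationary law is uniform on the lattice up to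
  a constant factor, so by a Chernoff bound every cell contains \<open>\<Theta>(R\<^sup>2)\<close> nodes at all times
  considered, except with probability at most \<open>1/n\<close>. The rest is deterministic and does not depend
  on how the nodes move between two rounds.

  In each round the cells of the nodes \<open>I\<close> informed before it and those of the nodes \<open>U\<close> still
  uninformed after it are not adjacent. Two non-adjacent sets of grid cells leave at least
  \<open>sqrt (min |A| |B|)\<close> other cells, and all nodes in those become informed in this very round.
  Hence \<open>sqrt |I| - sqrt |U|\<close>, which lies between \<open>- sqrt n\<close> and \<open>sqrt n\<close>, grows by a constant
  multiple of \<open>R\<close> in every round but the first and the last.
\<close>

section \<open>Non-adjacent cell sets and the growth of the informed set\<close>

text \<open>Equal cells or cells sharing a side. As equality counts, sets without adjacent pairs are
  in particular disjoint.\<close>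

definition cell_adj :: "nat \<times> nat \<Rightarrow> nat \<times> nat \<Rightarrow> bool" where
  "cell_adj c d \<longleftrightarrow> \<bar>int (fst c) - int (fst d)\<bar> + \<bar>int (snd c) - int (snd d)\<bar> \<le> 1"

lemma cell_adj_commute: "cell_adj c d \<longleftrightarrow> cell_adj d c"
  by (auto simp: cell_adj_def abs_minus_commute)

text \<open>By \<open>sep\<close>, neighbouring positions cannot carry different colours, so the
  colour of position 0 propagates along the whole line.\<close>

lemma two_coloured_line:
  fixes p q :: "nat \<Rightarrow> bool"
  assumes cover: "\<And>j. j < K \<Longrightarrow> p j \<or> q j"
    and sep: "\<And>i j. p i \<Longrightarrow> q j \<Longrightarrow> \<bar>int i - int j\<bar> > 1"
  shows "(\<forall>j<K. p j) \<or> (\<forall>j<K. q j)"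
proof (cases "p 0")
  case True
  have "j < K \<Longrightarrow> p j" for j
  proof (induction j)
    case (Suc j)
    then have "p j" by simp
    then have "\<not> q (Suc j)" using sep[of j "Suc j"] by auto
    with cover Suc.prems show ?case by blast
  qed (use True in simp)
  then show ?thesis by blast
next
  case False
  have "j < K \<Longrightarrow> q j" for j
  proof (induction j)
    case (Suc j)
    then have "q j" by simp
    then have "\<not> p (Suc j)" using sep[of "Suc j" j] by auto
    with cover Suc.prems show ?case by blast
  qed (use False cover in blast)
  then show ?thesis by blast
qed

text \<open>A gap-free row or column is monochromatic. Every column meets the full row of
  \<open>A\<close>, so each column that meets \<open>B\<close> contains a gap cell. Together with a
  similar count for rows this suffices, since \<open>B\<close> lies in the product of its two
  projections.\<close>

lemma grid_gap_of_full_row: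
  fixes A B :: "(nat \<times> nat) set"
  assumes sub: "A \<subseteq> {..<K} \<times> {..<K}" "B \<subseteq> {..<K} \<times> {..<K}"
    and sep: "\<And>a b. a \<in> A \<Longrightarrow> b \<in> B \<Longrightarrow> \<not> cell_adj a b"
    and i0: "i0 < K" "\<And>j. j < K \<Longrightarrow> (i0, j) \<in> A"
  shows "card B \<le> (card ({..<K} \<times> {..<K} - A - B))\<^sup>2"
proof -
  define G where "G = {..<K} \<times> {..<K} - A - B"
  have fin: "finite G" "finite B" using sub(2) by (auto simp: G_def intro: finite_subset)
  have row: "(\<forall>j<K. (i, j) \<in> A) \<or> (\<forall>j<K. (i, j) \<in> B)"
    if "i < K" "i \<notin> fst ` G" for i
  proof (rule two_coloured_line)
    fix j assume "j < K"
    moreover have "(i, j) \<notin> G" using that(2) imageI[of "(i, j)" G fst] by auto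
    ultimately show "(i, j) \<in> A \<or> (i, j) \<in> B" using that(1) by (auto simp: G_def)
  next
    fix j j' assume "(i, j) \<in> A" "(i, j') \<in> B"
    then show "\<bar>int j - int j'\<bar> > 1" using sep[of "(i,j)" "(i,j')"] by (auto simp: cell_adj_def)
  qed
  have col: "(\<forall>i<K. (i, j) \<in> A) \<or> (\<forall>i<K. (i, j) \<in> B)"
    if "j < K" "j \<notin> snd ` G" for j
  proof (rule two_coloured_line)
    fix i assume "i < K"
    moreover have "(i, j) \<notin> G" using that(2) imageI[of "(i, j)" G snd] by auto
    ultimately show "(i, j) \<in> A \<or> (i, j) \<in> B" using that(1) by (auto simp: G_def)
  next
    fix i i' assume "(i, j) \<in> A" "(i', j) \<in> B"
    then show "\<bar>int i - int i'\<bar> > 1" using sep[of "(i,j)" "(i',j)"] by (auto simp: cell_adj_def)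
  qed
  have disj: "x \<notin> B" if "x \<in> A" for x using sep[of x x] that by (auto simp: cell_adj_def)
  have cB: "snd ` B \<subseteq> snd ` G"
  proof
    fix j assume "j \<in> snd ` B"
    then obtain i where ij: "(i, j) \<in> B" by auto
    then have "i < K" "j < K" using sub by auto
    then show "j \<in> snd ` G" using col[of j] i0 disj ij by blast
  qed
  \<comment> \<open>Either every column contains a gap cell, so \<open>card G\<close> is at least
    \<open>K\<close>, or some column is gap-free. The latter meets row \<open>i0\<close>, hence lies
    in \<open>A\<close>, and then every row that meets \<open>B\<close> contains a gap cell.\<close>
  have rB: "card (fst ` B) \<le> card G"
  proof (cases "{..<K} \<subseteq> snd ` G")
    case True
    have "card (fst ` B) \<le> card {..<K}"
      using sub(2) by (intro card_mono) auto
    also have "\<dots> \<le> card (snd ` G)" using True fin by (intro card_mono) auto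
    also have "\<dots> \<le> card G" using fin by (rule_tac card_image_le)
    finally show ?thesis .
  next
    case False
    then obtain j0 where j0: "j0 < K" "j0 \<notin> snd ` G" by auto
    then have all: "(i, j0) \<in> A" if "i < K" for i using col[of j0] i0 disj that by blast
    have "fst ` B \<subseteq> fst ` G"
    proof
      fix i assume "i \<in> fst ` B"
      then obtain j where ij: "(i, j) \<in> B" by auto
      then have "i < K" "j < K" using sub by auto
      then show "i \<in> fst ` G" using row[of i] all[of i] j0 disj ij by blast
    qed
    then have "card (fst ` B) \<le> card (fst ` G)" using fin by (intro card_mono) auto
    also have "\<dots> \<le> card G" using fin by (rule_tac card_image_le)
    finally show ?thesis .
  qed
  have "card (snd ` B) \<le> card (snd ` G)" using fin cB by (intro card_mono) auto
  also have "\<dots> \<le> card G" using fin by (rule_tac card_image_le)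
  finally have c: "card (snd ` B) \<le> card G" .
  have "card B \<le> card (fst ` B \<times> snd ` B)"
    using fin by (intro card_mono subset_fst_snd) auto
  also have "\<dots> \<le> card G * card G" unfolding card_cartesian_product by (intro mult_mono rB c) auto
  finally show ?thesis by (simp add: G_def power2_eq_square)
qed

text \<open>If every row contains a gap cell, the gap has at least \<open>K\<close> cells, and
  \<open>A\<close> has at most \<open>K * K\<close>. Otherwise a gap-free row lies entirely in
  \<open>A\<close> or in \<open>B\<close>, and the full-row lemma bounds the other set.\<close>

lemma grid_gap:
  fixes A B :: "(nat \<times> nat) set"
  assumes sub: "A \<subseteq> {..<K} \<times> {..<K}" "B \<subseteq> {..<K} \<times> {..<K}"
    and sep: "\<And>a b. a \<in> A \<Longrightarrow> b \<in> B \<Longrightarrow> \<not> cell_adj a b"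
  shows "min (card A) (card B) \<le> (card ({..<K} \<times> {..<K} - A - B))\<^sup>2"
proof -
  define G where "G = {..<K} \<times> {..<K} - A - B"
  have fin: "finite G" by (auto simp: G_def)
  show ?thesis
  proof (cases "{..<K} \<subseteq> fst ` G")
    case True
    have "K = card {..<K}" by simp
    also have "\<dots> \<le> card (fst ` G)" using True fin by (intro card_mono) auto
    also have "\<dots> \<le> card G" using fin by (rule card_image_le)
    finally have "K * K \<le> card G * card G" by (intro mult_mono) auto
    moreover have "card A \<le> card ({..<K} \<times> {..<K})" using sub(1) by (intro card_mono) auto
    ultimately show ?thesis by (simp add: G_def power2_eq_square)
  next
    case False
    then obtain i where i: "i < K" "i \<notin> fst ` G" by auto
    have "(\<forall>j<K. (i, j) \<in> A) \<or> (\<forall>j<K. (i, j) \<in> B)"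
    proof (rule two_coloured_line)
      fix j assume "j < K"
      moreover have "(i, j) \<notin> G" using i(2) imageI[of "(i, j)" G fst] by auto
      ultimately show "(i, j) \<in> A \<or> (i, j) \<in> B" using i(1) by (auto simp: G_def)
    next
      fix j j' assume "(i, j) \<in> A" "(i, j') \<in> B"
      then show "\<bar>int j - int j'\<bar> > 1" using sep[of "(i,j)" "(i,j')"] by (auto simp: cell_adj_def)
    qed
    then show ?thesis
    proof
      assume "\<forall>j<K. (i, j) \<in> A"
      then have "card B \<le> (card G)\<^sup>2"
        unfolding G_def using i sub sep by (intro grid_gap_of_full_row) auto
      then show ?thesis by (simp add: G_def)
    next
      assume "\<forall>j<K. (i, j) \<in> B"
      then have "card A \<le> (card ({..<K} \<times> {..<K} - B - A))\<^sup>2"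
        using i sub sep cell_adj_commute by (intro grid_gap_of_full_row) blast+
      moreover have "{..<K} \<times> {..<K} - B - A = G" by (auto simp: G_def)
      ultimately show ?thesis by (simp add: G_def)
    qed
  qed
qed

text \<open>Passes from cells to nodes: with at most \<open>M\<close> nodes per cell, a node set
  \<open>S\<close> occupies at least \<open>card S / M\<close> cells, while each gap cell supplies
  at least \<open>m\<close> nodes outside both \<open>I\<close> and \<open>U\<close>.\<close>

lemma separated_nodes_gap:
  fixes cl :: "nat \<Rightarrow> nat \<times> nat" and m M :: real
  assumes IU: "I \<subseteq> {..<n}" "U \<subseteq> {..<n}"
    and cl: "\<And>i. i < n \<Longrightarrow> cl i \<in> {..<K} \<times> {..<K}"
    and sep: "\<And>i j. i \<in> I \<Longrightarrow> j \<in> U \<Longrightarrow> \<not> cell_adj (cl i) (cl j)"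
    and cnt: "\<And>c. c \<in> {..<K} \<times> {..<K} \<Longrightarrow> m \<le> real (card {i \<in> {..<n}. cl i = c})"
      "\<And>c. c \<in> {..<K} \<times> {..<K} \<Longrightarrow> real (card {i \<in> {..<n}. cl i = c}) \<le> M"
    and mM: "0 \<le> m" "0 < M"
  shows "m * sqrt (min (real (card I)) (real (card U)) / M) \<le> real (card ({..<n} - I - U))"
proof -
  define A B where "A = cl ` I" and "B = cl ` U"
  define G where "G = {..<K} \<times> {..<K} - A - B"
  have finG: "finite G" by (simp add: G_def)
  have sub: "A \<subseteq> {..<K} \<times> {..<K}" "B \<subseteq> {..<K} \<times> {..<K}"
    using IU unfolding A_def B_def by (intro image_subsetI cl; auto)+
  have gap: "min (card A) (card B) \<le> (card G)\<^sup>2"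
    unfolding G_def
  proof (rule grid_gap[OF sub])
    fix a b assume "a \<in> A" "b \<in> B"
    then show "\<not> cell_adj a b" using sep unfolding A_def B_def by blast
  qed
  have up: "real (card S) \<le> M * real (card (cl ` S))" if S: "S \<subseteq> {..<n}" for S
  proof -
    have finS: "finite S" using that finite_subset by blast
    have "card S \<le> card (\<Union>c\<in>cl ` S. {i \<in> {..<n}. cl i = c})"
      using that finS by (intro card_mono) auto
    also have "\<dots> \<le> (\<Sum>c\<in>cl ` S. card {i \<in> {..<n}. cl i = c})"
      using finS by (intro card_UN_le) auto
    finally have "real (card S) \<le> real (\<Sum>c\<in>cl ` S. card {i \<in> {..<n}. cl i = c})"
      by (rule of_nat_mono)
    also have "\<dots> = (\<Sum>c\<in>cl ` S. real (card {i \<in> {..<n}. cl i = c}))"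
      by (rule of_nat_sum)
    also have "\<dots> \<le> (\<Sum>c\<in>cl ` S. M)"
    proof (rule sum_mono)
      fix c assume "c \<in> cl ` S"
      then obtain i where "i < n" "c = cl i" using S by auto
      then show "real (card {i \<in> {..<n}. cl i = c}) \<le> M" using cl cnt(2) by simp
    qed
    finally show ?thesis by (simp add: mult.commute)
  qed
  have "min (real (card I)) (real (card U)) \<le> M * real (min (card A) (card B))"
    using up[OF IU(1)] up[OF IU(2)] unfolding A_def B_def by (simp add: min_def)
  also have "\<dots> \<le> M * (real (card G))\<^sup>2"
    using of_nat_mono[OF gap, where 'a = real] mM by (intro mult_left_mono) auto
  finally have "sqrt (min (real (card I)) (real (card U)) / M) \<le> sqrt ((real (card G))\<^sup>2)"
    using mM by (intro real_sqrt_le_mono) (simp add: field_simps)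
  then have "m * sqrt (min (real (card I)) (real (card U)) / M) \<le> (\<Sum>c\<in>G. m)"
    using mM by (simp add: mult.commute mult_left_mono)
  also have "\<dots> \<le> (\<Sum>c\<in>G. real (card {i \<in> {..<n}. cl i = c}))"
    by (intro sum_mono cnt(1)) (simp add: G_def)
  also have "\<dots> = real (card (\<Union>c\<in>G. {i \<in> {..<n}. cl i = c}))"
    using finG by (subst card_UN_disjoint) auto
  also have "\<dots> \<le> real (card ({..<n} - I - U))"
    unfolding of_nat_le_iff
  proof (intro card_mono subsetI)
    fix i assume "i \<in> (\<Union>c\<in>G. {i \<in> {..<n}. cl i = c})"
    then have "i < n" "cl i \<in> G" by auto
    then show "i \<in> {..<n} - I - U" by (auto simp: G_def A_def B_def)
  qed simp
  finally show ?thesis .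
qed

text \<open>Since \<open>g \<le> sqrt x\<close>, the square of \<open>sqrt x + g\<close> is at most
  \<open>x + 3 * g * sqrt x\<close>. Thus an increment of order \<open>sqrt x\<close> becomes a
  constant increment of the square root.\<close>

lemma sqrt_growth:
  fixes x y g :: real
  assumes "g \<ge> 0" "g\<^sup>2 \<le> x" "x + 3 * g * sqrt x \<le> y"
  shows "sqrt x + g \<le> sqrt y"
proof -
  have x: "x \<ge> 0" using assms(2) zero_le_power2[of g] by linarith
  have "g \<le> sqrt x" using assms by (simp add: real_le_rsqrt)
  then have "g * g \<le> g * sqrt x" using assms(1) by (rule mult_left_mono)
  then have "(sqrt x + g)\<^sup>2 \<le> x + 3 * g * sqrt x"
    using x by (simp add: power2_eq_square algebra_simps)
  then show ?thesis using assms(3) by (intro real_le_rsqrt) auto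
qed

section \<open>Flooding when all cells are balanced\<close>

lemma informed_subset: "s < n \<Longrightarrow> informed n R P s t \<subseteq> {..<n}"
  by (induction t) auto

lemma informed_mono: "t \<le> t' \<Longrightarrow> informed n R P s t \<subseteq> informed n R P s t'"
  by (rule lift_Suc_mono_le[of "informed n R P s"]) auto

lemma flooding_time_leI:
  assumes "0 < n" "t \<le> H" "\<And>s. s < n \<Longrightarrow> informed n R P s t = {..<n}"
  shows "flooding_time n R P \<le> enat H"
proof -
  have "flood_from n R P s \<le> enat H" if "s < n" for s
  proof -
    have "(LEAST t. informed n R P s t = {..<n}) \<le> t"
      using assms(3)[OF that] by (rule Least_le)
    then show ?thesis using assms(2,3) that by (auto simp: flood_from_def)
  qed
  then show ?thesis unfolding flooding_time_def using assms(1) by (intro Max.boundedI) auto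
qed

text \<open>By contradiction: while both sets are nonempty, the potential \<open>\<phi>\<close>
  stays strictly between \<open>- sqrt (real n)\<close> and \<open>sqrt (real n)\<close>, yet it
  gains \<open>\<gamma>\<close> in each of \<open>T - 2\<close> rounds.\<close>

lemma informed_all_of_balanced_cells:
  fixes P :: "nat \<Rightarrow> nat \<Rightarrow> point" and cl :: "point \<Rightarrow> nat \<times> nat" and R :: real
  assumes s: "s < n" and R: "0 < R"
    and cl: "\<And>t i. t < T \<Longrightarrow> i < n \<Longrightarrow> cl (P i t) \<in> {..<K} \<times> {..<K}"
    and near: "\<And>t i j. t < T \<Longrightarrow> i < n \<Longrightarrow> j < n \<Longrightarrow> cell_adj (cl (P i t)) (cl (P j t)) \<Longrightarrow>
      dist (P i t) (P j t) \<le> R"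
    and lo: "\<And>t c. t < T \<Longrightarrow> c \<in> {..<K} \<times> {..<K} \<Longrightarrow>
      (R / 64)\<^sup>2 \<le> real (card {i \<in> {..<n}. cl (P i t) = c})"
    and hi: "\<And>t c. t < T \<Longrightarrow> c \<in> {..<K} \<times> {..<K} \<Longrightarrow>
      real (card {i \<in> {..<n}. cl (P i t) = c}) \<le> (4 * R)\<^sup>2"
    and T: "2 + 98304 * sqrt (real n) / R \<le> real T"
  shows "informed n R P s T = {..<n}"
proof (rule ccontr)
  assume not_all: "informed n R P s T \<noteq> {..<n}"
  define I where "I = informed n R P s"
  define U where "U t = {..<n} - I t" for t
  \<comment> \<open>Chosen so that
    \<open>(R / 64)\<^sup>2 / (4 * R) = R / 16384 = 3 * \<gamma>\<close>, the factor that
    \<open>sqrt_growth\<close> needs. The 98304 in the bound on \<open>T\<close> is 2 *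
    49152.\<close>
  define \<gamma> where "\<gamma> = R / 49152"
  have \<gamma>: "\<gamma> > 0" using R by (simp add: \<gamma>_def)
  have Isub: "I t \<subseteq> {..<n}" for t unfolding I_def using s by (rule informed_subset)
  have finI: "finite (I t)" "finite (U t)" for t using finite_subset[OF Isub] by (auto simp: U_def)
  have mono: "I t \<subseteq> I t'" if "t \<le> t'" for t t' unfolding I_def using that by (rule informed_mono)
  have Une: "U t \<noteq> {}" if "t \<le> T" for t
    using not_all Isub[of T] mono[OF that] by (auto simp: U_def I_def)
  have sI: "s \<in> I t" for t using mono[of 0 t] by (auto simp: I_def)
  have sep: "\<not> cell_adj (cl (P i t)) (cl (P j t))" if "t < T" "i \<in> I t" "j \<in> U (Suc t)" for t i j
  proof
    assume "cell_adj (cl (P i t)) (cl (P j t))"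
    then have "dist (P i t) (P j t) \<le> R"
      using that Isub by (intro near) (auto simp: U_def)
    then show False using that by (auto simp: U_def I_def)
  qed
  have adj_refl: "cell_adj c c" for c by (simp add: cell_adj_def)
  \<comment> \<open>The source is informed at all times, so round \<open>t\<close> informs its whole
    current cell.\<close>
  have bigI: "(R / 64)\<^sup>2 \<le> real (card (I (Suc t)))" if "t < T" for t
  proof -
    have "{i \<in> {..<n}. cl (P i t) = cl (P s t)} \<subseteq> I (Suc t)"
    proof
      fix i assume i: "i \<in> {i \<in> {..<n}. cl (P i t) = cl (P s t)}"
      then show "i \<in> I (Suc t)" using sep[OF that sI, of i] adj_refl by (auto simp: U_def)
    qed
    then have "card {i \<in> {..<n}. cl (P i t) = cl (P s t)} \<le> card (I (Suc t))"
      using finI by (intro card_mono) auto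
    then show ?thesis using lo[OF that cl[OF that s]] by linarith
  qed
  \<comment> \<open>Had any node in the cell of \<open>j\<close> been informed at time
    \<open>t\<close>, then \<open>j\<close> would be informed at \<open>Suc t\<close>.\<close>
  have bigU: "(R / 64)\<^sup>2 \<le> real (card (U t))" if t: "t < T" for t
  proof -
    obtain j where j: "j \<in> U (Suc t)" using Une[of "Suc t"] t by auto
    then have jn: "j < n" by (auto simp: U_def)
    have "{i \<in> {..<n}. cl (P i t) = cl (P j t)} \<subseteq> U t"
    proof
      fix i assume i: "i \<in> {i \<in> {..<n}. cl (P i t) = cl (P j t)}"
      then show "i \<in> U t" using sep[OF that _ j, of i] adj_refl by (auto simp: U_def)
    qed
    then have "card {i \<in> {..<n}. cl (P i t) = cl (P j t)} \<le> card (U t)"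
      using finI by (intro card_mono) auto
    then show ?thesis using lo[OF that cl[OF that jn]] by linarith
  qed
  have cIU: "card (I t) + card (U t) = n" for t
    using Isub[of t] finI[of t] card_Un_disjoint[of "I t" "U t"] by (auto simp: U_def Un_absorb1)
  define \<phi> where "\<phi> t = sqrt (real (card (I t))) - sqrt (real (card (U t)))" for t
  \<comment> \<open>Round 0 is left out because \<open>I 0\<close> is a single node, the last round
    because \<open>bigU\<close> is applied at \<open>Suc t\<close>.\<close>
  have step: "\<phi> t + \<gamma> \<le> \<phi> (Suc t)" if t: "0 < t" "Suc t < T" for t
  proof -
    let ?x = "real (card (I t))" and ?u = "real (card (U t))"
    let ?x' = "real (card (I (Suc t)))" and ?u' = "real (card (U (Suc t)))"
    have sqrt4R: "sqrt ((4 * R)\<^sup>2) = 4 * R" using R by (simp only: real_sqrt_abs)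
    have "(R / 64)\<^sup>2 * sqrt (min ?x ?u' / (4 * R)\<^sup>2) \<le> real (card ({..<n} - I t - U (Suc t)))"
    proof (rule separated_nodes_gap[where cl = "\<lambda>i. cl (P i t)" and K = K])
      show "U (Suc t) \<subseteq> {..<n}" by (auto simp: U_def)
      have "t < T" using t by simp
      then show "cl (P i t) \<in> {..<K} \<times> {..<K}" if "i < n" for i
        using that by (rule cl)
      show "\<not> cell_adj (cl (P i t)) (cl (P j t))" if "i \<in> I t" "j \<in> U (Suc t)" for i j
        using \<open>t < T\<close> that by (rule sep)
      show "(R / 64)\<^sup>2 \<le> real (card {i \<in> {..<n}. cl (P i t) = c})"
        "real (card {i \<in> {..<n}. cl (P i t) = c}) \<le> (4 * R)\<^sup>2" if "c \<in> {..<K} \<times> {..<K}" for c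
        using lo hi \<open>t < T\<close> that by blast+
    qed (use R Isub in simp_all)
    also have "{..<n} - I t - U (Suc t) = I (Suc t) - I t"
      using Isub by (auto simp: U_def)
    also have "real (card (I (Suc t) - I t)) = ?x' - ?x"
      using mono[of t "Suc t"] finI by (subst card_Diff_subset) (auto simp: card_mono of_nat_diff)
    also have "(R / 64)\<^sup>2 * sqrt (min ?x ?u' / (4 * R)\<^sup>2) = 3 * \<gamma> * sqrt (min ?x ?u')"
      unfolding real_sqrt_divide sqrt4R using R by (simp add: \<gamma>_def power2_eq_square)
    finally have gr: "3 * \<gamma> * sqrt (min ?x ?u') \<le> ?x' - ?x" .
    have xu: "?x' - ?x = ?u - ?u'" using cIU[of t] cIU[of "Suc t"] by linarith
    have gr0: "0 \<le> ?x' - ?x" using mono[of t "Suc t"] finI by (simp add: card_mono)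
    have g2: "\<gamma>\<^sup>2 \<le> (R / 64)\<^sup>2" using R by (intro power_mono) (auto simp: \<gamma>_def)
    have bx: "\<gamma>\<^sup>2 \<le> ?x" using order_trans[OF g2 bigI[of "t - 1"]] t by simp
    have bu: "\<gamma>\<^sup>2 \<le> ?u'" using bigU[of "Suc t"] t g2 by linarith
    \<comment> \<open>The smaller set drives the progress. If it is \<open>U (Suc t)\<close>, then
      \<open>sqrt_growth\<close> is read backwards in time, from \<open>?u'\<close> up to
      \<open>?u\<close>.\<close>
    show ?thesis
    proof (cases "?x \<le> ?u'")
      case True
      then have "sqrt ?x + \<gamma> \<le> sqrt ?x'"
        using gr bx \<gamma> by (intro sqrt_growth) auto
      moreover have "sqrt ?u' \<le> sqrt ?u" using gr0 xu by simp
      ultimately show ?thesis unfolding \<phi>_def by linarith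
    next
      case False
      then have "sqrt ?u' + \<gamma> \<le> sqrt ?u"
        using gr bu \<gamma> xu by (intro sqrt_growth) auto
      moreover have "sqrt ?x \<le> sqrt ?x'" using gr0 by simp
      ultimately show ?thesis unfolding \<phi>_def by linarith
    qed
  qed
  have "0 \<le> 98304 * sqrt (real n) / R" using R by simp
  then have T2: "T \<ge> 2" using T by linarith
  have acc: "\<phi> 1 + real k * \<gamma> \<le> \<phi> (Suc k)" if "Suc k < T" for k
    using that
  proof (induction k)
    case (Suc k)
    then show ?case using step[of "Suc k"] by (simp add: algebra_simps)
  qed simp
  have "\<phi> 1 + real (T - 2) * \<gamma> \<le> \<phi> (Suc (T - 2))" using T2 by (intro acc) auto
  moreover have "2 * sqrt (real n) \<le> real (T - 2) * \<gamma>"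
    using T T2 R by (simp add: \<gamma>_def of_nat_diff field_simps)
  \<comment> \<open>Strictness comes from both sets being nonempty; it is what contradicts a gain of
    at least \<open>2 * sqrt (real n)\<close>.\<close>
  moreover have "\<bar>\<phi> t\<bar> < sqrt (real n)" if "t \<le> T" for t
  proof -
    have "0 < card (I t)" using finI sI[of t] by (auto simp: card_gt_0_iff)
    then have "0 < sqrt (real (card (I t)))" by simp
    moreover have "0 < card (U t)" using finI Une[OF that] by (auto simp: card_gt_0_iff)
    then have "0 < sqrt (real (card (U t)))" by simp
    moreover have "sqrt (real (card (I t))) \<le> sqrt (real n)"
      "sqrt (real (card (U t))) \<le> sqrt (real n)"
      using cIU[of t] by auto
    ultimately show ?thesis unfolding \<phi>_def by linarith
  qed
  from this[of 1] this[of "Suc (T - 2)"] have "\<bar>\<phi> 1\<bar> < sqrt (real n)"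
    "\<bar>\<phi> (Suc (T - 2))\<bar> < sqrt (real n)"
    using T2 by auto
  ultimately show False by linarith
qed

section \<open>The stationary law\<close>

text \<open>The number of lattice coordinates per axis; \<open>Suc\<close> counts the coordinate 0.
  Neighbourhoods and cells are counted via integer index pairs below this bound.\<close>

definition lattice_side :: "nat \<Rightarrow> real \<Rightarrow> nat" where
  "lattice_side n \<epsilon> = Suc (nat \<lfloor>sqrt (real n) / \<epsilon>\<rfloor>)"

definition lattice_point :: "real \<Rightarrow> nat \<times> nat \<Rightarrow> point" where
  "lattice_point \<epsilon> p = (real (fst p) * \<epsilon>, real (snd p) * \<epsilon>)"

lemma lattice_eq_image:
  assumes "\<epsilon> > 0"
  shows "lattice n \<epsilon> = lattice_point \<epsilon> ` ({..<lattice_side n \<epsilon>} \<times> {..<lattice_side n \<epsilon>})"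
proof -
  have "real i \<le> sqrt (real n) / \<epsilon> \<longleftrightarrow> i < lattice_side n \<epsilon>" for i
    using assms by (simp add: lattice_side_def less_Suc_eq_le le_nat_iff le_floor_iff)
  then have "lattice n \<epsilon> = {lattice_point \<epsilon> (i, j) | i j. i < lattice_side n \<epsilon> \<and> j < lattice_side n \<epsilon>}"
    by (simp add: lattice_def lattice_point_def)
  then show ?thesis by auto
qed

lemma inj_lattice_point: "\<epsilon> > 0 \<Longrightarrow> inj_on (lattice_point \<epsilon>) A"
  by (auto simp: inj_on_def lattice_point_def)

lemma finite_lattice: "\<epsilon> > 0 \<Longrightarrow> finite (lattice n \<epsilon>)"
  by (simp add: lattice_eq_image)

lemma card_lattice: "\<epsilon> > 0 \<Longrightarrow> card (lattice n \<epsilon>) = (lattice_side n \<epsilon>)\<^sup>2"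
  by (simp add: lattice_eq_image card_image inj_lattice_point power2_eq_square)

lemma lattice_side_pos: "0 < lattice_side n \<epsilon>"
  by (simp add: lattice_side_def)

lemma dist_lattice_point:
  "\<epsilon> > 0 \<Longrightarrow> dist (lattice_point \<epsilon> p) (lattice_point \<epsilon> p') =
    \<epsilon> * sqrt ((real (fst p) - real (fst p'))\<^sup>2 + (real (snd p) - real (snd p'))\<^sup>2)"
  by (simp add: lattice_point_def dist_Pair_Pair dist_real_def power_mult_distrib real_sqrt_mult
      flip: left_diff_distrib distrib_right)

lemma dist_lattice_point_mono:
  assumes "\<epsilon> > 0" "\<bar>real (fst p) - real (fst q)\<bar> \<le> \<bar>real (fst p') - real (fst q')\<bar>"
    "\<bar>real (snd p) - real (snd q)\<bar> \<le> \<bar>real (snd p') - real (snd q')\<bar>"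
  shows "dist (lattice_point \<epsilon> p) (lattice_point \<epsilon> q)
    \<le> dist (lattice_point \<epsilon> p') (lattice_point \<epsilon> q')"
  using assms by (simp add: dist_lattice_point add_mono abs_le_square_iff)

section \<open>Neighbourhood sizes up to a factor of four\<close>

definition index_nbhd :: "nat \<Rightarrow> real \<Rightarrow> real \<Rightarrow> nat \<times> nat \<Rightarrow> (nat \<times> nat) set" where
  "index_nbhd n \<epsilon> r p = {q \<in> {..<lattice_side n \<epsilon>} \<times> {..<lattice_side n \<epsilon>}.
     dist (lattice_point \<epsilon> p) (lattice_point \<epsilon> q) \<le> r}"

lemma finite_index_nbhd: "finite (index_nbhd n \<epsilon> r p)"
  by (simp add: index_nbhd_def)

lemma card_nbhd_lattice_point:
  assumes "\<epsilon> > 0"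
  shows "card (nbhd n \<epsilon> r (lattice_point \<epsilon> p)) = card (index_nbhd n \<epsilon> r p)"
proof -
  have "nbhd n \<epsilon> r (lattice_point \<epsilon> p) = lattice_point \<epsilon> ` index_nbhd n \<epsilon> r p"
    using assms by (auto simp: nbhd_def index_nbhd_def lattice_eq_image)
  then show ?thesis using assms by (simp add: card_image inj_lattice_point)
qed

text \<open>
  Reflecting \<open>{0..a}\<close> and fixing the rest is an involution of each interval \<open>{0..k}\<close> with \<open>k \<ge> a\<close>
  that takes \<open>d\<close> to a point at distance at most \<open>d\<close> from \<open>a\<close>.
\<close>

definition reflect :: "nat \<Rightarrow> nat \<Rightarrow> nat" where
  "reflect a d = (if d \<le> a then a - d else d)"

text \<open>Applied in both coordinates, \<open>reflect\<close> is injective, stays inside the grid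
  and puts each point at least as close to \<open>p\<close> as it was to the origin.\<close>

lemma card_index_nbhd_origin_le:
  assumes \<epsilon>: "\<epsilon> > 0" and p: "p \<in> {..<lattice_side n \<epsilon>} \<times> {..<lattice_side n \<epsilon>}"
  shows "card (index_nbhd n \<epsilon> r (0, 0)) \<le> card (index_nbhd n \<epsilon> r p)"
proof (rule card_inj_on_le)
  let ?f = "map_prod (reflect (fst p)) (reflect (snd p))"
  have "reflect a (reflect a d) = d" for a d by (auto simp: reflect_def)
  then have "inj (reflect a)" for a by (metis injI)
  then have "inj ?f" by (intro prod.inj_map)
  then show "inj_on ?f (index_nbhd n \<epsilon> r (0, 0))" by (rule inj_on_subset) simp
  show "?f ` index_nbhd n \<epsilon> r (0, 0) \<subseteq> index_nbhd n \<epsilon> r p"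
  proof
    fix x assume "x \<in> ?f ` index_nbhd n \<epsilon> r (0, 0)"
    then obtain d where d: "d \<in> index_nbhd n \<epsilon> r (0, 0)" and x: "x = ?f d" by auto
    have lt: "reflect a e < l" if "a < l" "e < l" for a e l :: nat
      using that by (auto simp: reflect_def)
    have near: "\<bar>real a - real (reflect a e)\<bar> \<le> real e" for a e by (auto simp: reflect_def)
    have "dist (lattice_point \<epsilon> p) (lattice_point \<epsilon> x)
      \<le> dist (lattice_point \<epsilon> (0, 0)) (lattice_point \<epsilon> d)"
      using \<epsilon> near by (intro dist_lattice_point_mono) (auto simp: x)
    then show "x \<in> index_nbhd n \<epsilon> r p"
      using d p lt by (auto simp: index_nbhd_def x)
  qed
qed (rule finite_index_nbhd)

text \<open>A neighbour of \<open>p\<close> is determined by its absolute offsets from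
  \<open>p\<close>, which form a neighbour of the origin, and one sign per coordinate; the four sign
  patterns give the factor.\<close>

lemma card_index_nbhd_le:
  assumes \<epsilon>: "\<epsilon> > 0" and p: "p \<in> {..<lattice_side n \<epsilon>} \<times> {..<lattice_side n \<epsilon>}"
  shows "card (index_nbhd n \<epsilon> r p) \<le> 4 * card (index_nbhd n \<epsilon> r (0, 0))"
proof -
  define h :: "bool \<Rightarrow> nat \<Rightarrow> nat \<Rightarrow> nat" where "h b a d = (if b then a + d else a - d)" for b a d
  define f where "f = (\<lambda>((b, b'), d). (h b (fst p) (fst d), h b' (snd p) (snd d)))"
  define e where "e a i = (if a \<le> i then i - a else a - i)" for a i :: nat
  have he: "h (a \<le> i) a (e a i) = i" for a i by (auto simp: h_def e_def)
  have "index_nbhd n \<epsilon> r p \<subseteq> f ` (UNIV \<times> index_nbhd n \<epsilon> r (0, 0))"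
  proof
    fix x assume x: "x \<in> index_nbhd n \<epsilon> r p"
    let ?d = "(e (fst p) (fst x), e (snd p) (snd x))"
    let ?b = "(fst p \<le> fst x, snd p \<le> snd x)"
    have "x = f (?b, ?d)" by (simp add: f_def he)
    moreover have "?d \<in> index_nbhd n \<epsilon> r (0, 0)"
    proof -
      have "dist (lattice_point \<epsilon> (0, 0)) (lattice_point \<epsilon> ?d)
        \<le> dist (lattice_point \<epsilon> p) (lattice_point \<epsilon> x)"
        using \<epsilon> by (intro dist_lattice_point_mono) (auto simp: e_def)
      moreover have "e a i < l" if "a < l" "i < l" for a i l using that by (auto simp: e_def)
      ultimately show ?thesis using x p by (auto simp: index_nbhd_def)
    qed
    ultimately show "x \<in> f ` (UNIV \<times> index_nbhd n \<epsilon> r (0, 0))"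
      by (intro image_eqI[where x = "(?b, ?d)"]) simp_all
  qed
  then have "card (index_nbhd n \<epsilon> r p)
    \<le> card (UNIV \<times> index_nbhd n \<epsilon> r (0, 0) :: ((bool \<times> bool) \<times> (nat \<times> nat)) set)"
    by (intro surj_card_le) (auto simp: finite_index_nbhd)
  also have "\<dots> = 4 * card (index_nbhd n \<epsilon> r (0, 0))"
    by (simp add: card_cartesian_product card_UNIV_bool flip: UNIV_Times_UNIV)
  finally show ?thesis .
qed

text \<open>The smallest degree in the lattice, used as the yardstick for all others.\<close>

definition origin_degree :: "nat \<Rightarrow> real \<Rightarrow> real \<Rightarrow> nat" where
  "origin_degree n \<epsilon> r = card (index_nbhd n \<epsilon> r (0, 0))"

lemma card_nbhd_bounds:
  assumes "\<epsilon> > 0" "x \<in> lattice n \<epsilon>"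
  shows "origin_degree n \<epsilon> r \<le> card (nbhd n \<epsilon> r x)" "card (nbhd n \<epsilon> r x) \<le> 4 * origin_degree n \<epsilon> r"
  using assms card_index_nbhd_origin_le card_index_nbhd_le
  by (auto simp: lattice_eq_image card_nbhd_lattice_point origin_degree_def)

lemma origin_degree_pos: "r \<ge> 0 \<Longrightarrow> 0 < origin_degree n \<epsilon> r"
  unfolding origin_degree_def card_gt_0_iff
  by (auto simp: finite_index_nbhd index_nbhd_def lattice_side_pos intro!: exI[of _ 0])

lemma finite_nbhd: "\<epsilon> > 0 \<Longrightarrow> finite (nbhd n \<epsilon> r x)"
  by (simp add: nbhd_def finite_lattice)

lemma lattice_nonempty: "\<epsilon> > 0 \<Longrightarrow> lattice n \<epsilon> \<noteq> {}"
  using lattice_side_pos[of n \<epsilon>] by (auto simp: lattice_eq_image)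

lemma degree_sum_bounds:
  assumes "\<epsilon> > 0"
  shows "real (card (lattice n \<epsilon>)) * real (origin_degree n \<epsilon> r)
    \<le> (\<Sum>y\<in>lattice n \<epsilon>. real (card (nbhd n \<epsilon> r y)))"
    and "(\<Sum>y\<in>lattice n \<epsilon>. real (card (nbhd n \<epsilon> r y)))
      \<le> real (card (lattice n \<epsilon>)) * (4 * real (origin_degree n \<epsilon> r))"
proof -
  have "(\<Sum>y\<in>lattice n \<epsilon>. real (origin_degree n \<epsilon> r)) \<le> (\<Sum>y\<in>lattice n \<epsilon>. real (card (nbhd n \<epsilon> r y)))"
    using card_nbhd_bounds[OF assms] by (intro sum_mono) auto
  then show "real (card (lattice n \<epsilon>)) * real (origin_degree n \<epsilon> r)
    \<le> (\<Sum>y\<in>lattice n \<epsilon>. real (card (nbhd n \<epsilon> r y)))"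
    by simp
  have "(\<Sum>y\<in>lattice n \<epsilon>. real (card (nbhd n \<epsilon> r y)))
    \<le> (\<Sum>y\<in>lattice n \<epsilon>. 4 * real (origin_degree n \<epsilon> r))"
  proof (rule sum_mono)
    fix y assume "y \<in> lattice n \<epsilon>"
    from of_nat_mono[OF card_nbhd_bounds(2)[OF assms this], where 'a = real]
    show "real (card (nbhd n \<epsilon> r y)) \<le> 4 * real (origin_degree n \<epsilon> r)" by simp
  qed
  then show "(\<Sum>y\<in>lattice n \<epsilon>. real (card (nbhd n \<epsilon> r y)))
    \<le> real (card (lattice n \<epsilon>)) * (4 * real (origin_degree n \<epsilon> r))"
    by simp
qed

lemma degree_sum_pos:
  assumes "\<epsilon> > 0" "r \<ge> 0"
  shows "0 < (\<Sum>y\<in>lattice n \<epsilon>. real (card (nbhd n \<epsilon> r y)))"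
proof -
  have "0 < real (card (lattice n \<epsilon>)) * real (origin_degree n \<epsilon> r)"
    using assms by (auto simp: origin_degree_pos card_gt_0_iff finite_lattice lattice_nonempty)
  then show ?thesis using degree_sum_bounds(1)[OF assms(1), of n r] by linarith
qed

lemma pmf_stat_pmf:
  assumes "\<epsilon> > 0" "r \<ge> 0"
  shows "pmf (stat_pmf n \<epsilon> r) x = (if x \<in> lattice n \<epsilon>
      then real (card (nbhd n \<epsilon> r x)) / (\<Sum>y\<in>lattice n \<epsilon>. real (card (nbhd n \<epsilon> r y))) else 0)"
  unfolding stat_pmf_def
proof (rule pmf_embed_pmf)
  let ?Z = "\<Sum>y\<in>lattice n \<epsilon>. real (card (nbhd n \<epsilon> r y))"
  let ?f = "\<lambda>x. if x \<in> lattice n \<epsilon> then real (card (nbhd n \<epsilon> r x)) / ?Z else 0"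
  note Z = degree_sum_pos[OF assms, of n]
  show "0 \<le> ?f x" for x using Z by (simp add: less_imp_le)
  have "(\<integral>\<^sup>+x. ennreal (?f x) \<partial>count_space UNIV) = (\<Sum>x\<in>lattice n \<epsilon>. ennreal (?f x))"
    using assms by (intro nn_integral_count_space') (auto simp: finite_lattice)
  also have "\<dots> = ennreal (\<Sum>x\<in>lattice n \<epsilon>. ?f x)"
    using Z by (intro sum_ennreal) (simp add: less_imp_le)
  also have "(\<Sum>x\<in>lattice n \<epsilon>. ?f x) = 1"
    using Z by (simp flip: sum_divide_distrib)
  finally show "(\<integral>\<^sup>+x. ennreal (?f x) \<partial>count_space UNIV) = 1" by simp
qed

lemma set_stat_pmf_subset:
  "\<epsilon> > 0 \<Longrightarrow> r \<ge> 0 \<Longrightarrow> set_pmf (stat_pmf n \<epsilon> r) \<subseteq> lattice n \<epsilon>"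
  by (auto simp: set_pmf_iff pmf_stat_pmf split: if_splits)

text \<open>With \<open>d\<close> the corner degree and \<open>L\<close> the number of lattice
  points, degrees lie between \<open>d\<close> and \<open>4 * d\<close> and the normaliser between
  \<open>L * d\<close> and \<open>L * (4 * d)\<close>. So the law is uniform up to a factor 4,
  whatever \<open>r\<close> is.\<close>

lemma pmf_stat_pmf_bounds:
  assumes "\<epsilon> > 0" "r \<ge> 0" "x \<in> lattice n \<epsilon>"
  shows "1 / (4 * (real (lattice_side n \<epsilon>))\<^sup>2) \<le> pmf (stat_pmf n \<epsilon> r) x"
    and "pmf (stat_pmf n \<epsilon> r) x \<le> 4 / (real (lattice_side n \<epsilon>))\<^sup>2"
proof -
  define Z where "Z = (\<Sum>y\<in>lattice n \<epsilon>. real (card (nbhd n \<epsilon> r y)))"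
  define L d c where "L = (real (lattice_side n \<epsilon>))\<^sup>2" and "d = real (origin_degree n \<epsilon> r)"
    and "c = real (card (nbhd n \<epsilon> r x))"
  have pos: "0 < Z" "0 < L" "0 < d"
    using degree_sum_pos[OF assms(1,2)] origin_degree_pos[OF assms(2)] lattice_side_pos
    by (auto simp: Z_def L_def d_def)
  have Z: "L * d \<le> Z" "Z \<le> L * (4 * d)"
    using degree_sum_bounds[OF assms(1), of n r] assms(1)
      by (simp_all add: Z_def L_def d_def card_lattice)
  have c: "d \<le> c" "c \<le> 4 * d"
    using card_nbhd_bounds[OF assms(1,3), of r] by (auto simp: c_def d_def)
  have eq: "pmf (stat_pmf n \<epsilon> r) x = c / Z" using assms by (simp add: pmf_stat_pmf c_def Z_def)
  have "Z \<le> 4 * L * c" using Z(2) mult_left_mono[OF c(1), of "4 * L"] pos by linarith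
  then show "1 / (4 * (real (lattice_side n \<epsilon>))\<^sup>2) \<le> pmf (stat_pmf n \<epsilon> r) x"
    unfolding eq using pos by (simp add: field_simps flip: L_def)
  have "L * c \<le> 4 * Z" using Z(1) mult_left_mono[OF c(2), of L] pos by linarith
  then show "pmf (stat_pmf n \<epsilon> r) x \<le> 4 / (real (lattice_side n \<epsilon>))\<^sup>2"
    unfolding eq using pos by (simp add: field_simps flip: L_def)
qed

text \<open>The stationary weight of \<open>x\<close> cancels the degree in the move, so each move
  has joint probability \<open>1 / Z\<close>. The points with \<open>y\<close> as a neighbour are,
  by symmetry of the distance, the neighbours of \<open>y\<close>.\<close>

lemma bind_stat_pmf_move_pmf:
  assumes "\<epsilon> > 0" "r \<ge> 0"
  shows "bind_pmf (stat_pmf n \<epsilon> r) (move_pmf n \<epsilon> r) = stat_pmf n \<epsilon> r"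
proof (rule pmf_eqI)
  fix y
  let ?L = "lattice n \<epsilon>"
  define Z where "Z = (\<Sum>y\<in>?L. real (card (nbhd n \<epsilon> r y)))"
  have ne: "nbhd n \<epsilon> r x \<noteq> {}" if "x \<in> ?L" for x
    using that assms(2) dist_self[of x] unfolding nbhd_def by fastforce
  have "pmf (bind_pmf (stat_pmf n \<epsilon> r) (move_pmf n \<epsilon> r)) y =
      (\<Sum>x\<in>?L. pmf (move_pmf n \<epsilon> r x) y * pmf (stat_pmf n \<epsilon> r) x)"
    unfolding pmf_bind using assms set_stat_pmf_subset
    by (intro integral_measure_pmf_real) (auto simp: finite_lattice)
  also have "\<dots> = (\<Sum>x\<in>?L. indicator (nbhd n \<epsilon> r x) y / Z)"
  proof (rule sum.cong[OF refl])
    fix x assume x: "x \<in> ?L"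
    have "card (nbhd n \<epsilon> r x) \<noteq> 0" using ne[OF x] finite_nbhd assms by auto
    then show "pmf (move_pmf n \<epsilon> r x) y * pmf (stat_pmf n \<epsilon> r) x = indicator (nbhd n \<epsilon> r x) y / Z"
      using x ne[OF x] assms by (simp add: move_pmf_def finite_nbhd pmf_stat_pmf Z_def)
  qed
  also have "\<dots> = (\<Sum>x\<in>?L. indicator {x. y \<in> nbhd n \<epsilon> r x} x) / Z"
    by (simp add: sum_divide_distrib indicator_def)
  also have "(\<Sum>x\<in>?L. indicator {x. y \<in> nbhd n \<epsilon> r x} x) = real (card (?L \<inter> {x. y \<in> nbhd n \<epsilon> r x}))"
    using assms by (simp add: finite_lattice indicator_def of_bool_def sum.If_cases)
  also have "?L \<inter> {x. y \<in> nbhd n \<epsilon> r x} = (if y \<in> ?L then nbhd n \<epsilon> r y else {})"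
    by (auto simp: nbhd_def dist_commute)
  finally show "pmf (bind_pmf (stat_pmf n \<epsilon> r) (move_pmf n \<epsilon> r)) y = pmf (stat_pmf n \<epsilon> r) y"
    using assms by (simp add: pmf_stat_pmf Z_def)
qed

lemma map_pmf_walk_pmf_stationary:
  assumes "bind_pmf \<mu> K = \<mu>"
  shows "map_pmf (\<lambda>w. w t) (walk_pmf K \<mu> T) = \<mu>"
proof (induction T arbitrary: t)
  case 0
  show ?case by (simp add: map_pmf_comp)
next
  case (Suc T)
  show ?case
  proof (cases "t \<le> T")
    case True
    then have "map_pmf (\<lambda>w. w t) (walk_pmf K \<mu> (Suc T)) = map_pmf (\<lambda>w. w t) (walk_pmf K \<mu> T)"
      by (simp add: map_bind_pmf map_pmf_comp map_pmf_const) (simp add: map_pmf_def)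
    then show ?thesis using Suc by simp
  next
    case False
    then have "map_pmf (\<lambda>w. w t) (walk_pmf K \<mu> (Suc T))
      = bind_pmf (map_pmf (\<lambda>w. w T) (walk_pmf K \<mu> T)) K"
      by (simp add: map_bind_pmf map_pmf_comp bind_map_pmf)
    then show ?thesis using Suc assms by simp
  qed
qed

section \<open>Chernoff bounds\<close>

lemma expectation_exp_count_Pi_pmf_le:
  fixes p :: "'a pmf" and s :: real
  shows "measure_pmf.expectation (Pi_pmf {..<n} dflt (\<lambda>_. p))
      (\<lambda>f. exp (s * real (card {i \<in> {..<n}. f i \<in> S})))
    \<le> exp (real n * measure_pmf.prob p S * (exp s - 1))"
proof -
  let ?g = "\<lambda>x. 1 + (exp s - 1) * indicat_real S x"
  have g0: "0 \<le> ?g x" for x by (auto simp: indicator_def)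
  have bd: "norm (?g x) \<le> 1 + exp s" for x by (auto simp: indicator_def)
  have intS: "integrable (measure_pmf p) (indicat_real S)"
    by (rule measure_pmf.integrable_const_bound[where B = 1]) (auto simp: indicator_def)
  have int: "integrable (measure_pmf p) ?g"
    by (rule measure_pmf.integrable_const_bound[where B = "1 + exp s"]) (use bd in auto)
  have "exp (s * real (card {i \<in> {..<n}. f i \<in> S})) = (\<Prod>i\<in>{..<n}. ?g (f i))" for f
  proof -
    have "(\<Prod>i\<in>{..<n}. ?g (f i)) = (\<Prod>i\<in>{..<n}. if f i \<in> S then exp s else 1)"
      by (intro prod.cong) auto
    also have "\<dots> = exp s ^ card {i \<in> {..<n}. f i \<in> S}"
      by (simp add: prod.If_cases Int_def)
    finally show ?thesis by (simp add: exp_of_nat2_mult)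
  qed
  then have "measure_pmf.expectation (Pi_pmf {..<n} dflt (\<lambda>_. p))
      (\<lambda>f. exp (s * real (card {i \<in> {..<n}. f i \<in> S}))) =
    measure_pmf.expectation (Pi_pmf {..<n} dflt (\<lambda>_. p)) (\<lambda>f. \<Prod>i\<in>{..<n}. ?g (f i))"
    by simp
  also have "\<dots> = (\<Prod>i\<in>{..<n}. measure_pmf.expectation p ?g)"
    using g0 int by (intro expectation_prod_Pi_pmf) auto
  also have "measure_pmf.expectation p ?g = 1 + (exp s - 1) * measure_pmf.prob p S"
    using intS by (subst Bochner_Integration.integral_add) auto
  also have "(\<Prod>i\<in>{..<n}. 1 + (exp s - 1) * measure_pmf.prob p S)
    \<le> (\<Prod>i\<in>{..<n}. exp ((exp s - 1) * measure_pmf.prob p S))"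
  proof (rule prod_mono)
    \<comment> \<open>A combination of 1 and \<open>exp s\<close> with nonnegative weights: each
      factor is nonnegative, also for negative \<open>s\<close>, as \<open>prod_mono\<close>
      requires.\<close>
    have "0 \<le> (1 - measure_pmf.prob p S) + exp s * measure_pmf.prob p S" by simp
    then show "0 \<le> 1 + (exp s - 1) * measure_pmf.prob p S \<and>
        1 + (exp s - 1) * measure_pmf.prob p S
          \<le> exp ((exp s - 1) * measure_pmf.prob p S)" for i :: nat
      using exp_ge_add_one_self[of "(exp s - 1) * measure_pmf.prob p S"]
        by (simp add: algebra_simps)
  qed
  also have "\<dots> = exp (real n * measure_pmf.prob p S * (exp s - 1))"
    by (simp add: exp_of_nat_mult[symmetric] mult_ac)
  finally show ?thesis .
qed

text \<open>Markov's inequality for the exponential, which is integrable because \<open>B\<close>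
  bounds it.\<close>

lemma prob_exp_Markov:
  fixes X :: "'a \<Rightarrow> nat" and p :: "'a pmf" and s a :: real
  assumes bd: "\<And>x. X x \<le> B"
  shows "measure_pmf.prob p {x. a \<le> s * real (X x)}
    \<le> exp (- a) * measure_pmf.expectation p (\<lambda>x. exp (s * real (X x)))"
proof -
  have "s * real (X x) \<le> \<bar>s\<bar> * real B" for x
  proof -
    have "s * real (X x) \<le> \<bar>s\<bar> * real (X x)" by (intro mult_right_mono) auto
    also have "\<dots> \<le> \<bar>s\<bar> * real B" using bd by (intro mult_left_mono) auto
    finally show ?thesis .
  qed
  then have "integrable (measure_pmf p) (\<lambda>x. exp (s * real (X x)))"
    by (intro measure_pmf.integrable_const_bound[where B = "exp (\<bar>s\<bar> * real B)"]) auto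
  then have "measure_pmf.prob p {x \<in> space (measure_pmf p). exp a \<le> exp (s * real (X x))}
      \<le> measure_pmf.expectation p (\<lambda>x. exp (s * real (X x))) / exp a"
    by (intro integral_Markov_inequality_measure[where A = "{}"]) auto
  then show ?thesis by (simp add: exp_minus divide_inverse mult.commute)
qed

text \<open>The choice \<open>s = 1\<close> with \<open>exp 1 - 1 \<le> 2\<close>; effective for
  thresholds above twice the mean.\<close>

lemma Chernoff_upper:
  fixes p :: "'a pmf"
  shows "measure_pmf.prob (Pi_pmf {..<n} dflt (\<lambda>_. p)) {f. a \<le> real (card {i \<in> {..<n}. f i \<in> S})}
    \<le> exp (2 * (real n * measure_pmf.prob p S) - a)"
proof -
  let ?M = "Pi_pmf {..<n} dflt (\<lambda>_. p)" and ?X = "\<lambda>f. card {i \<in> {..<n}. f i \<in> S}"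
  have e: "exp 1 - 1 \<le> (2 :: real)" using exp_le by simp
  have "?X f \<le> n" for f using card_mono[of "{..<n}" "{i \<in> {..<n}. f i \<in> S}"] by auto
  then have "measure_pmf.prob ?M {f. a \<le> 1 * real (?X f)}
    \<le> exp (- a) * measure_pmf.expectation ?M (\<lambda>f. exp (1 * real (?X f)))"
    by (rule prob_exp_Markov)
  also have "\<dots> \<le> exp (- a) * exp (real n * measure_pmf.prob p S * (exp 1 - 1))"
    by (intro mult_left_mono expectation_exp_count_Pi_pmf_le) auto
  also have "\<dots> \<le> exp (- a) * exp (real n * measure_pmf.prob p S * 2)"
    unfolding exp_le_cancel_iff mult_le_cancel_left_pos[OF exp_gt_zero]
    using e by (rule mult_left_mono) simp
  finally show ?thesis by (simp add: mult_exp_exp algebra_simps)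
qed

text \<open>The choice \<open>s = -1\<close> with \<open>exp (- 1) - 1 \<le> - 1 / 2\<close>;
  effective for thresholds below half the mean.\<close>

lemma Chernoff_lower:
  fixes p :: "'a pmf"
  shows "measure_pmf.prob (Pi_pmf {..<n} dflt (\<lambda>_. p)) {f. real (card {i \<in> {..<n}. f i \<in> S}) \<le> a}
    \<le> exp (a - real n * measure_pmf.prob p S / 2)"
proof -
  let ?M = "Pi_pmf {..<n} dflt (\<lambda>_. p)" and ?X = "\<lambda>f. card {i \<in> {..<n}. f i \<in> S}"
  have "2 \<le> exp (1 :: real)" using exp_ge_add_one_self[of 1] by simp
  then have e: "exp (- 1) - 1 \<le> (- 1 / 2 :: real)" by (simp add: exp_minus field_simps)
  have "?X f \<le> n" for f using card_mono[of "{..<n}" "{i \<in> {..<n}. f i \<in> S}"] by auto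
  then have "measure_pmf.prob ?M {f. - a \<le> (- 1) * real (?X f)}
    \<le> exp (- (- a)) * measure_pmf.expectation ?M (\<lambda>f. exp ((- 1) * real (?X f)))"
    by (rule prob_exp_Markov)
  also have "\<dots> \<le> exp (- (- a)) * exp (real n * measure_pmf.prob p S * (exp (- 1) - 1))"
    by (intro mult_left_mono expectation_exp_count_Pi_pmf_le) auto
  also have "\<dots> \<le> exp (- (- a)) * exp (real n * measure_pmf.prob p S * (- 1 / 2))"
    unfolding exp_le_cancel_iff mult_le_cancel_left_pos[OF exp_gt_zero]
    using e by (rule mult_left_mono) simp
  finally show ?thesis by (simp add: mult_exp_exp algebra_simps)
qed

section \<open>Balanced cells\<close>

lemma nat_div_eq_iff:
  fixes i K q b :: nat
  assumes "0 < q"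
  shows "i * K div q = b \<longleftrightarrow> b * q \<le> i * K \<and> i * K < (b + 1) * q"
  using assms less_eq_div_iff_mult_less_eq[of q b "i * K"] div_less_iff_less_mult[of q "i * K"
    "b + 1"]
  by auto

text \<open>Block \<open>b\<close> consists of the integers in a half-open interval of length
  \<open>q / K\<close>. Rounding its ends changes the count by less than 1, at most half the length
  because \<open>2 * K \<le> q\<close>.\<close>

lemma block_card_bounds:
  fixes q K b :: nat
  assumes K: "0 < K" "2 * K \<le> q" and b: "b < K"
  shows "real q / (2 * real K) \<le> real (card {i \<in> {..<q}. i * K div q = b})"
    and "real (card {i \<in> {..<q}. i * K div q = b}) \<le> 2 * real q / real K"
proof -
  define x y where "x = real b * real q / real K" and "y = real (b + 1) * real q / real K"
  have q: "0 < q" using K by linarith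
  have yx: "y = x + real q / real K" by (simp add: x_def y_def algebra_simps add_divide_distrib)
  have qK: "2 \<le> real q / real K" using K by (simp add: field_simps)
  have x0: "0 \<le> x" by (simp add: x_def)
  have lo: "nat \<lceil>x\<rceil> \<le> i \<longleftrightarrow> b * q \<le> i * K" for i
  proof -
    have "nat \<lceil>x\<rceil> \<le> i \<longleftrightarrow> real (b * q) \<le> real (i * K)"
      using K by (simp add: x_def nat_ceiling_le_eq field_simps)
    then show ?thesis by (simp only: of_nat_le_iff)
  qed
  have hi: "nat \<lceil>y\<rceil> \<le> i \<longleftrightarrow> (b + 1) * q \<le> i * K" for i
  proof -
    have "nat \<lceil>y\<rceil> \<le> i \<longleftrightarrow> real ((b + 1) * q) \<le> real (i * K)"
      using K by (simp add: y_def nat_ceiling_le_eq field_simps)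
    then show ?thesis by (simp only: of_nat_le_iff)
  qed
  have "i < q" if "i * K < (b + 1) * q" for i
  proof -
    have "(b + 1) * q \<le> K * q" using b by (intro mult_right_mono) auto
    with that have "i * K < K * q" by (rule less_le_trans)
    then show ?thesis by simp
  qed
  then have "{i \<in> {..<q}. i * K div q = b} = {nat \<lceil>x\<rceil>..<nat \<lceil>y\<rceil>}"
    using lo hi nat_div_eq_iff[OF q] by (auto simp: not_le[symmetric])
  then have "real (card {i \<in> {..<q}. i * K div q = b}) = real (nat \<lceil>y\<rceil> - nat \<lceil>x\<rceil>)" by simp
  also have "\<dots> = of_int \<lceil>y\<rceil> - of_int \<lceil>x\<rceil>"
  proof -
    have le: "\<lceil>x\<rceil> \<le> \<lceil>y\<rceil>" using yx qK by (intro ceiling_mono) simp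
    have "0 \<le> \<lceil>x\<rceil>" using x0 by linarith
    then have "nat \<lceil>y\<rceil> - nat \<lceil>x\<rceil> = nat (\<lceil>y\<rceil> - \<lceil>x\<rceil>)" using le by (simp only: nat_diff_distrib)
    then show ?thesis using le by (simp only: of_nat_nat diff_ge_0_iff_ge of_int_diff)
  qed
  finally have c: "real (card {i \<in> {..<q}. i * K div q = b}) = of_int \<lceil>y\<rceil> - of_int \<lceil>x\<rceil>" .
  have ceil: "x \<le> of_int \<lceil>x\<rceil>" "of_int \<lceil>x\<rceil> < x + 1" "y \<le> of_int \<lceil>y\<rceil>" "of_int \<lceil>y\<rceil> < y + 1"
    by linarith+
  define z where "z = real q / real K"
  have half: "real q / (2 * real K) = z / 2" by (simp add: z_def)
  show "real q / (2 * real K) \<le> real (card {i \<in> {..<q}. i * K div q = b})"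
    unfolding c half using qK yx ceil unfolding z_def[symmetric] by linarith
  show "real (card {i \<in> {..<q}. i * K div q = b}) \<le> 2 * real q / real K"
    unfolding c using qK yx ceil by linarith
qed

text \<open>Indices whose blocks are k apart differ by at most k + 1 block widths
  \<open>q / K\<close>, stated here without division.\<close>

lemma block_dist:
  fixes i i' K q :: nat
  assumes "0 < q"
  shows "\<bar>real i - real i'\<bar> * real K \<le> (\<bar>real (i * K div q) - real (i' * K div q)\<bar> + 1) * real q"
proof -
  have *: "(real i - real i') * real K \<le> (\<bar>real (i * K div q) - real (i' * K div q)\<bar> + 1) * real q"
    for i i' :: nat
  proof -
    define b b' where "b = i * K div q" and "b' = i' * K div q"
    have "i * K < (b + 1) * q" "b' * q \<le> i' * K"
      using nat_div_eq_iff[OF assms] b_def b'_def by blast+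
    then have "real (i * K) \<le> real ((b + 1) * q)" "real (b' * q) \<le> real (i' * K)" by linarith+
    then have "(real i - real i') * real K \<le> (real b - real b' + 1) * real q"
      by (simp add: algebra_simps)
    also have "\<dots> \<le> (\<bar>real b - real b'\<bar> + 1) * real q" by (intro mult_right_mono) auto
    finally show ?thesis by (simp only: b_def b'_def)
  qed
  show ?thesis
  proof (cases "i \<ge> i'")
    case True
    then show ?thesis using *[of i i'] by simp
  next
    case False
    then show ?thesis using *[of i' i] by (simp add: abs_minus_commute)
  qed
qed

text \<open>
  Cells are blocks of lattice indices rather than of coordinates, so that those along the border
  are not smaller than the others.
\<close>

definition cell_of :: "real \<Rightarrow> nat \<Rightarrow> nat \<Rightarrow> point \<Rightarrow> nat \<times> nat" where
  "cell_of \<epsilon> q K x = (nat \<lfloor>fst x / \<epsilon>\<rfloor> * K div q, nat \<lfloor>snd x / \<epsilon>\<rfloor> * K div q)"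

lemma cell_of_lattice_point:
  "\<epsilon> > 0 \<Longrightarrow> cell_of \<epsilon> q K (lattice_point \<epsilon> p) = (fst p * K div q, snd p * K div q)"
  by (simp add: cell_of_def lattice_point_def)

lemma cell_of_in_grid:
  assumes "\<epsilon> > 0" "0 < K" "x \<in> lattice n \<epsilon>"
  shows "cell_of \<epsilon> (lattice_side n \<epsilon>) K x \<in> {..<K} \<times> {..<K}"
proof -
  have "i * K div lattice_side n \<epsilon> < K" if "i < lattice_side n \<epsilon>" for i
    using that assms(2) lattice_side_pos by (simp add: div_less_iff_less_mult mult.commute)
  then show ?thesis using assms by (auto simp: lattice_eq_image cell_of_lattice_point)
qed

text \<open>Cell coordinates differ by at most 1 in total, and each axis adds one block width of
  slack: at most 3 widths in all, the 3 in the assumption on \<open>K\<close>.\<close>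

lemma dist_le_of_cell_adj:
  assumes \<epsilon>: "\<epsilon> > 0" and K: "0 < K" "3 * (real (lattice_side n \<epsilon>) * \<epsilon>) \<le> real K * R"
    and x: "x \<in> lattice n \<epsilon>" and y: "y \<in> lattice n \<epsilon>"
    and adj: "cell_adj (cell_of \<epsilon> (lattice_side n \<epsilon>) K x) (cell_of \<epsilon> (lattice_side n \<epsilon>) K y)"
  shows "dist x y \<le> R"
proof -
  define q where "q = lattice_side n \<epsilon>"
  have q: "0 < q" by (simp add: q_def lattice_side_pos)
  obtain p p' where p: "x = lattice_point \<epsilon> p" "y = lattice_point \<epsilon> p'"
    using x y \<epsilon> by (auto simp: lattice_eq_image)
  define u v where "u = \<bar>real (fst p * K div q) - real (fst p' * K div q)\<bar>"
    and "v = \<bar>real (snd p * K div q) - real (snd p' * K div q)\<bar>"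
  let ?a = "\<bar>real (fst p) - real (fst p')\<bar>" and ?b = "\<bar>real (snd p) - real (snd p')\<bar>"
  have "\<bar>int (fst p * K div q) - int (fst p' * K div q)\<bar>
    + \<bar>int (snd p * K div q) - int (snd p' * K div q)\<bar> \<le> 1"
    using adj \<epsilon> by (simp add: p cell_of_lattice_point cell_adj_def q_def)
  then have "real_of_int (\<bar>int (fst p * K div q) - int (fst p' * K div q)\<bar>
    + \<bar>int (snd p * K div q) - int (snd p' * K div q)\<bar>) \<le> 1"
    by linarith
  then have uv: "u + v \<le> 1" by (simp add: u_def v_def)
  have "(?a + ?b) * real K \<le> (u + v + 2) * real q"
    using block_dist[OF q, of "fst p" "fst p'" K] block_dist[OF q, of "snd p" "snd p'" K]
    unfolding u_def v_def by (simp add: algebra_simps)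
  also have "\<dots> \<le> 3 * real q" using uv by (intro mult_right_mono) auto
  finally have "(?a + ?b) * real K * \<epsilon> \<le> 3 * real q * \<epsilon>" using \<epsilon> by (intro mult_right_mono) auto
  also have "\<dots> \<le> real K * R" using K(2) by (simp add: q_def)
  finally have "real K * (\<epsilon> * (?a + ?b)) \<le> real K * R" by (simp only: mult_ac)
  then have "\<epsilon> * (?a + ?b) \<le> R" using K(1) by (simp only: mult_le_cancel_left_pos of_nat_0_less_iff)
  moreover have "dist x y \<le> \<epsilon> * (?a + ?b)"
    unfolding p dist_lattice_point[OF \<epsilon>]
      using \<epsilon> by (intro mult_left_mono sqrt_sum_squares_le_sum_abs) auto
  ultimately show ?thesis by linarith
qed

text \<open>A cell has \<open>(q / K)\<^sup>2\<close> lattice points up to a factor 4, each of mass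
  \<open>1 / q\<^sup>2\<close> up to a factor 4.\<close>

lemma prob_stat_pmf_cell_bounds:
  assumes \<epsilon>: "\<epsilon> > 0" and r: "r \<ge> 0" and K: "0 < K" "2 * K \<le> lattice_side n \<epsilon>"
    and c: "c \<in> {..<K} \<times> {..<K}"
  shows "1 / (16 * (real K)\<^sup>2) \<le> measure_pmf.prob (stat_pmf n \<epsilon> r) {x. cell_of \<epsilon> (lattice_side n \<epsilon>) K x = c}"
    and "measure_pmf.prob (stat_pmf n \<epsilon> r) {x. cell_of \<epsilon> (lattice_side n \<epsilon>) K x = c}
      \<le> 16 / (real K)\<^sup>2"
proof -
  define q where "q = lattice_side n \<epsilon>"
  define B where "B b = {i \<in> {..<q}. i * K div q = b}" for b
  define S where "S = {x \<in> lattice n \<epsilon>. cell_of \<epsilon> q K x = c}"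
  have q: "0 < real q" by (simp add: q_def lattice_side_pos)
  have K0: "0 < real K" using K by simp
  have "S = lattice_point \<epsilon> ` (B (fst c) \<times> B (snd c))"
    using \<epsilon> by (auto simp: S_def lattice_eq_image cell_of_lattice_point B_def q_def)
  then have cS: "real (card S) = real (card (B (fst c))) * real (card (B (snd c)))"
    using \<epsilon> by (simp add: card_image inj_lattice_point card_cartesian_product)
  have B: "real q / (2 * real K) \<le> real (card (B b))" "real (card (B b)) \<le> 2 * real q / real K"
    if "b < K" for b
    unfolding B_def using K that by (intro block_card_bounds; simp add: q_def)+
  have c': "fst c < K" "snd c < K" using c by auto
  have lo: "(real q / (2 * real K))\<^sup>2 \<le> real (card S)"
    unfolding cS power2_eq_square using B c' by (intro mult_mono) auto
  have hi: "real (card S) \<le> (2 * real q / real K)\<^sup>2"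
    unfolding cS power2_eq_square using B c' by (intro mult_mono) auto
  \<comment> \<open>Points off the lattice may get the same cell label, but they carry no
    mass.\<close>
  have "measure_pmf.prob (stat_pmf n \<epsilon> r) {x. cell_of \<epsilon> q K x = c}
    = measure_pmf.prob (stat_pmf n \<epsilon> r) S"
    using set_stat_pmf_subset[OF \<epsilon> r, of n]
    by (intro measure_pmf.finite_measure_eq_AE) (auto simp: AE_measure_pmf_iff S_def)
  also have "\<dots> = (\<Sum>x\<in>S. pmf (stat_pmf n \<epsilon> r) x)"
    using \<epsilon> by (intro measure_measure_pmf_finite) (simp add: S_def finite_lattice)
  finally have eq: "measure_pmf.prob (stat_pmf n \<epsilon> r) {x. cell_of \<epsilon> q K x = c} = \<dots>" .
  have "1 / (16 * (real K)\<^sup>2) = (real q / (2 * real K))\<^sup>2 * (1 / (4 * (real q)\<^sup>2))"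
    using q K0 by (simp add: power2_eq_square)
  also have "\<dots> \<le> real (card S) * (1 / (4 * (real q)\<^sup>2))" using lo by (intro mult_right_mono) auto
  also have "\<dots> \<le> (\<Sum>x\<in>S. pmf (stat_pmf n \<epsilon> r) x)"
    using \<epsilon> r by (intro sum_bounded_below) (auto simp: S_def q_def intro: pmf_stat_pmf_bounds)
  finally show "1 / (16 * (real K)\<^sup>2)
    \<le> measure_pmf.prob (stat_pmf n \<epsilon> r) {x. cell_of \<epsilon> (lattice_side n \<epsilon>) K x = c}"
    by (simp add: eq flip: q_def)
  have "(\<Sum>x\<in>S. pmf (stat_pmf n \<epsilon> r) x) \<le> real (card S) * (4 / (real q)\<^sup>2)"
    using \<epsilon> r by (intro sum_bounded_above) (auto simp: S_def q_def intro: pmf_stat_pmf_bounds)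
  also have "\<dots> \<le> (2 * real q / real K)\<^sup>2 * (4 / (real q)\<^sup>2)"
    using hi by (intro mult_right_mono) auto
  also have "\<dots> = 16 / (real K)\<^sup>2" using q K0 by (simp add: power2_eq_square)
  finally show "measure_pmf.prob (stat_pmf n \<epsilon> r) {x. cell_of \<epsilon> (lattice_side n \<epsilon>) K x = c}
    \<le> 16 / (real K)\<^sup>2"
    by (simp add: eq flip: q_def)
qed

section \<open>Cell counts in the stationary geometric-MEG\<close>

lemma meg_pmf_in_lattice:
  assumes "\<epsilon> > 0" "r \<ge> 0" "P \<in> set_pmf (meg_pmf n r \<epsilon> H)" "i < n"
  shows "P i t \<in> lattice n \<epsilon>"
proof -
  let ?W = "walk_pmf (move_pmf n \<epsilon> r) (stat_pmf n \<epsilon> r) H"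
  have "P i \<in> set_pmf ?W"
    using assms(3,4) by (auto simp: meg_pmf_def set_Pi_pmf PiE_dflt_def)
  then have "P i t \<in> set_pmf (map_pmf (\<lambda>w. w t) ?W)" by auto
  also have "map_pmf (\<lambda>w. w t) ?W = stat_pmf n \<epsilon> r"
    using assms by (intro map_pmf_walk_pmf_stationary bind_stat_pmf_move_pmf)
  finally show ?thesis using set_stat_pmf_subset[OF assms(1,2)] by auto
qed

text \<open>Whole trajectories are independent copies, so the Chernoff bounds apply to the
  trajectory set \<open>{w. w t \<in> S}\<close>, whose probability is the stationary one of
  \<open>S\<close>.\<close>

lemma prob_meg_count:
  assumes "\<epsilon> > 0" "r \<ge> 0"
  shows "measure_pmf.prob (meg_pmf n r \<epsilon> H) {P. a \<le> real (card {i \<in> {..<n}. P i t \<in> S})}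
      \<le> exp (2 * (real n * measure_pmf.prob (stat_pmf n \<epsilon> r) S) - a)" (is ?upper)
    and "measure_pmf.prob (meg_pmf n r \<epsilon> H) {P. real (card {i \<in> {..<n}. P i t \<in> S}) \<le> a}
      \<le> exp (a - real n * measure_pmf.prob (stat_pmf n \<epsilon> r) S / 2)" (is ?lower)
proof -
  let ?W = "walk_pmf (move_pmf n \<epsilon> r) (stat_pmf n \<epsilon> r) H"
  have "map_pmf (\<lambda>w. w t) ?W = stat_pmf n \<epsilon> r"
    using assms by (intro map_pmf_walk_pmf_stationary bind_stat_pmf_move_pmf)
  then have "measure_pmf.prob (stat_pmf n \<epsilon> r) S = measure_pmf.prob (map_pmf (\<lambda>w. w t) ?W) S"
    by simp
  also have "\<dots> = measure_pmf.prob ?W {w. w t \<in> S}" by (simp add: vimage_def)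
  finally have S: "measure_pmf.prob (stat_pmf n \<epsilon> r) S = measure_pmf.prob ?W {w. w t \<in> S}" .
  show ?upper unfolding S meg_pmf_def
    using Chernoff_upper[of n undefined ?W a "{w. w t \<in> S}"] by simp
  show ?lower unfolding S meg_pmf_def
    using Chernoff_lower[of n undefined ?W "{w. w t \<in> S}" a] by simp
qed

text \<open>As \<open>K * R\<close> is of order \<open>sqrt (real n)\<close>, the mean count lies
  between \<open>R\<^sup>2 / 1024\<close> and \<open>2 * R\<^sup>2\<close>. The exponents are then
  at most \<open>R\<^sup>2 / 4096 - R\<^sup>2 / 2048\<close> and
  \<open>4 * R\<^sup>2 - 16 * R\<^sup>2\<close>.\<close>

lemma prob_cell_unbalanced:
  assumes \<epsilon>: "\<epsilon> > 0" and r: "r \<ge> 0" and K: "0 < K" "2 * K \<le> lattice_side n \<epsilon>"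
    and KR: "3 * sqrt (real n) \<le> real K * R" "real K * R \<le> 8 * sqrt (real n)" and R: "0 < R"
    and c: "c \<in> {..<K} \<times> {..<K}"
  shows "measure_pmf.prob (meg_pmf n r \<epsilon> H)
     {P. let N = real (card {i \<in> {..<n}. cell_of \<epsilon> (lattice_side n \<epsilon>) K (P i t) = c})
         in N \<le> (R / 64)\<^sup>2 \<or> (4 * R)\<^sup>2 \<le> N} \<le> 2 * exp (- (R\<^sup>2 / 4096))"
proof -
  let ?M = "meg_pmf n r \<epsilon> H"
  define S where "S = {x. cell_of \<epsilon> (lattice_side n \<epsilon>) K x = c}"
  define p where "p = measure_pmf.prob (stat_pmf n \<epsilon> r) S"
  define X where "X P = real (card {i \<in> {..<n}. P i t \<in> S})" for P :: "nat \<Rightarrow> nat \<Rightarrow> point"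
  have p: "1 / (16 * (real K)\<^sup>2) \<le> p" "p \<le> 16 / (real K)\<^sup>2"
    unfolding p_def S_def by (rule prob_stat_pmf_cell_bounds[OF \<epsilon> r K c])+
  have K0: "0 < (real K)\<^sup>2" using K by simp
  have "(real K * R)\<^sup>2 \<le> (8 * sqrt (real n))\<^sup>2" using KR R by (intro power_mono) auto
  then have 1: "(real K)\<^sup>2 * R\<^sup>2 \<le> 64 * real n" by (simp add: power_mult_distrib)
  have "(3 * sqrt (real n))\<^sup>2 \<le> (real K * R)\<^sup>2" using KR R by (intro power_mono) auto
  then have 2: "9 * real n \<le> (real K)\<^sup>2 * R\<^sup>2" by (simp add: power_mult_distrib)
  have "R\<^sup>2 / 1024 \<le> real n * (1 / (16 * (real K)\<^sup>2))" using 1 K0 by (simp add: field_simps)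
  also have "\<dots> \<le> real n * p" using p by (intro mult_left_mono) auto
  finally have lo: "R\<^sup>2 / 1024 \<le> real n * p" .
  have "real n * p \<le> real n * (16 / (real K)\<^sup>2)" using p by (intro mult_left_mono) auto
  also have "\<dots> \<le> 2 * R\<^sup>2" using 2 K0 by (simp add: field_simps)
  finally have hi: "real n * p \<le> 2 * R\<^sup>2" .
  have "measure_pmf.prob ?M {P. X P \<le> (R / 64)\<^sup>2} \<le> exp ((R / 64)\<^sup>2 - real n * p / 2)"
    unfolding X_def p_def by (rule prob_meg_count(2)[OF \<epsilon> r])
  also have "\<dots> \<le> exp (- (R\<^sup>2 / 4096))" using lo by (simp add: power_divide)
  finally have A: "measure_pmf.prob ?M {P. X P \<le> (R / 64)\<^sup>2} \<le> exp (- (R\<^sup>2 / 4096))" .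
  have "measure_pmf.prob ?M {P. (4 * R)\<^sup>2 \<le> X P} \<le> exp (2 * (real n * p) - (4 * R)\<^sup>2)"
    unfolding X_def p_def by (rule prob_meg_count(1)[OF \<epsilon> r])
  also have "\<dots> \<le> exp (- (R\<^sup>2 / 4096))"
  proof -
    have "(4 * R)\<^sup>2 = 16 * R\<^sup>2" by (simp add: power_mult_distrib)
    then show ?thesis unfolding exp_le_cancel_iff using hi zero_le_power2[of R] by linarith
  qed
  finally have B: "measure_pmf.prob ?M {P. (4 * R)\<^sup>2 \<le> X P} \<le> exp (- (R\<^sup>2 / 4096))" .
  have "measure_pmf.prob ?M ({P. X P \<le> (R / 64)\<^sup>2} \<union> {P. (4 * R)\<^sup>2 \<le> X P})
    \<le> 2 * exp (- (R\<^sup>2 / 4096))"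
    using A B measure_Un_le[of "{P. X P \<le> (R / 64)\<^sup>2}" "measure_pmf ?M" "{P. (4 * R)\<^sup>2 \<le> X P}"]
      by simp
  then show ?thesis by (simp add: Let_def X_def S_def Un_def)
qed

text \<open>Union bound over \<open>T\<close> rounds and \<open>K\<^sup>2\<close> cells; outside the
  bad events the deterministic flooding lemma applies.\<close>

lemma prob_flooding_time_le:
  assumes n: "0 < n" and \<epsilon>: "\<epsilon> > 0" and r: "r \<ge> 0" and K: "0 < K" "2 * K \<le> lattice_side n \<epsilon>"
    and KR: "3 * sqrt (real n) \<le> real K * R" "real K * R \<le> 8 * sqrt (real n)"
      "3 * (real (lattice_side n \<epsilon>) * \<epsilon>) \<le> real K * R"
    and R: "0 < R" and T: "2 + 98304 * sqrt (real n) / R \<le> real T" "T \<le> H"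
  shows "1 - real T * (real K)\<^sup>2 * (2 * exp (- (R\<^sup>2 / 4096)))
    \<le> measure_pmf.prob (meg_pmf n r \<epsilon> H) {P. flooding_time n R P \<le> enat H}"
proof -
  let ?M = "meg_pmf n r \<epsilon> H" and ?G = "{..<K} \<times> {..<K}"
  let ?cl = "cell_of \<epsilon> (lattice_side n \<epsilon>) K"
  define bad where "bad t c = {P. let N = real (card {i \<in> {..<n}. ?cl (P i t) = c})
         in N \<le> (R / 64)\<^sup>2 \<or> (4 * R)\<^sup>2 \<le> N}" for t :: nat and c
  define good where "good = {P. flooding_time n R P \<le> enat H}"
  \<comment> \<open>Intersecting with the support ensures that all positions lie in the
    lattice.\<close>
  have sub: "- good \<inter> set_pmf ?M \<subseteq> (\<Union>(t, c)\<in>{..<T} \<times> ?G. bad t c)"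
  proof (rule ccontr)
    assume "\<not> ?thesis"
    then obtain P where P: "P \<in> set_pmf ?M" "P \<notin> good"
      and nb: "\<And>t c. t < T \<Longrightarrow> c \<in> ?G \<Longrightarrow> P \<notin> bad t c" by force
    have L: "P i t \<in> lattice n \<epsilon>" if "i < n" for i t
      using \<epsilon> r P(1) that by (rule meg_pmf_in_lattice)
    have "informed n R P s T = {..<n}" if "s < n" for s
    proof (rule informed_all_of_balanced_cells[where cl = ?cl and K = K, OF that R])
      show "?cl (P i t) \<in> ?G" if "i < n" for i t
        using \<epsilon> K(1) L[OF that] by (rule cell_of_in_grid)
      show "dist (P i t) (P j t) \<le> R"
        if "i < n" "j < n" "cell_adj (?cl (P i t)) (?cl (P j t))" for i j t
        using \<epsilon> K(1) KR(3) L[OF that(1)] L[OF that(2)] that(3) by (rule dist_le_of_cell_adj)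
      show "(R / 64)\<^sup>2 \<le> real (card {i \<in> {..<n}. ?cl (P i t) = c})"
        "real (card {i \<in> {..<n}. ?cl (P i t) = c}) \<le> (4 * R)\<^sup>2" if "t < T" "c \<in> ?G" for t c
        using nb[OF that] by (simp_all add: bad_def Let_def)
    qed (rule T(1))
    then have "P \<in> good" unfolding good_def using n T(2) by (auto intro: flooding_time_leI)
    then show False using P(2) by simp
  qed
  have "measure_pmf.prob ?M (- good) = measure_pmf.prob ?M (- good \<inter> set_pmf ?M)"
    by (simp add: measure_Int_set_pmf)
  also have "\<dots> \<le> measure_pmf.prob ?M (\<Union>(t, c)\<in>{..<T} \<times> ?G. bad t c)"
    by (intro measure_pmf.finite_measure_mono sub) simp
  also have "\<dots> \<le> (\<Sum>(t, c)\<in>{..<T} \<times> ?G. measure_pmf.prob ?M (bad t c))"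
    unfolding case_prod_beta by (intro measure_UNION_le) auto
  also have "\<dots> \<le> real (card ({..<T} \<times> ?G)) * (2 * exp (- (R\<^sup>2 / 4096)))"
  proof (rule sum_bounded_above, clarify)
    fix t i j assume "i < K" "j < K"
    then show "measure_pmf.prob ?M (bad t (i, j)) \<le> 2 * exp (- (R\<^sup>2 / 4096))"
      unfolding bad_def using prob_cell_unbalanced[OF \<epsilon> r K KR(1,2) R, of "(i, j)"] by simp
  qed
  also have "real (card ({..<T} \<times> ?G)) = real T * (real K)\<^sup>2"
    by (simp add: card_cartesian_product power2_eq_square)
  finally show ?thesis
    unfolding good_def[symmetric] using measure_pmf.prob_compl[of good ?M]
      by (simp add: Compl_eq_Diff_UNIV)
qed

section \<open>Choice of the constants\<close>

theorem mainTheorem8: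
  shows "\<exists>c C :: real. c > 0 \<and> C > 0 \<and>
    (\<exists>N :: nat. \<forall>n \<ge> N. \<forall>r \<epsilon> R :: real.
       0 \<le> r \<longrightarrow> 0 < \<epsilon> \<longrightarrow> \<epsilon> \<le> 1 \<longrightarrow> \<epsilon> < R \<longrightarrow>
       c * sqrt (ln (real n)) \<le> R \<longrightarrow> R \<le> sqrt (real n) \<longrightarrow>
       (let H = nat \<lfloor>C * (sqrt (real n) / R + ln (ln R))\<rfloor> in
          measure_pmf.prob (meg_pmf n r \<epsilon> H) {P. flooding_time n R P \<le> enat H}
            \<ge> 1 - 1 / real n))"
proof -
  have main: "1 - 1 / real n \<le> measure_pmf.prob (meg_pmf n r \<epsilon> H) {P. flooding_time n R P \<le> enat H}"
    if n: "20000000 \<le> n" and r: "0 \<le> r" and \<epsilon>: "0 < \<epsilon>" "\<epsilon> \<le> 1"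
      and R: "128 * sqrt (ln (real n)) \<le> R" "R \<le> sqrt (real n)"
      and H: "H = nat \<lfloor>98307 * (sqrt (real n) / R + ln (ln R))\<rfloor>"
    for n H :: nat and r \<epsilon> R :: real
  proof -
    define x where "x = sqrt (real n)"
    have n0: "0 < real n" using n by simp
    have x0: "0 < x" using n0 by (simp add: x_def)
    have x2: "x * x = real n" using n0 by (simp add: x_def)
    have ln3: "1 \<le> ln y" if "3 \<le> y" for y :: real
      using that exp_le by (subst ln_ge_iff) auto
    have ln1: "1 \<le> ln (real n)" using n by (intro ln3) simp
    have "128 * 1 \<le> 128 * sqrt (ln (real n))" using ln1 by (intro mult_left_mono) auto
    then have R128: "128 \<le> R" using R(1) by linarith
    then have R0: "0 < R" by linarith
    have xR: "1 \<le> x / R" using R0 R(2) by (simp add: x_def)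
    \<comment> \<open>Taken from \<open>q * \<epsilon> \<le> x + 1\<close> and the 3 block widths of
      \<open>dist_le_of_cell_adj\<close>. Rounding up adds at most \<open>R\<close> to
      \<open>K * R\<close>, which stays below \<open>8 * x\<close>.\<close>
    define K where "K = nat \<lceil>3 * (x + 1) / R\<rceil>"
    have K: "3 * (x + 1) / R \<le> real K" "real K \<le> 3 * (x + 1) / R + 1"
      using x0 R0 by (auto simp: K_def real_nat_ceiling_ge intro: less_imp_le)
    have K3: "3 * (x + 1) \<le> real K * R" using K(1) R0 by (simp add: field_simps)
    have "real K * R \<le> (3 * (x + 1) / R + 1) * R" using K(2) R0 by (intro mult_right_mono) auto
    also have "\<dots> = 3 * (x + 1) + R" using R0 by (simp add: field_simps)
    also have "\<dots> \<le> 8 * x" using R(2) R128 by (simp add: x_def)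
    finally have K8: "real K * R \<le> 8 * x" .
    have Kpos: "0 < K" using K3 x0 by (cases "K = 0") auto
    define q where "q = lattice_side n \<epsilon>"
    have q: "x / \<epsilon> \<le> real q" "real q \<le> x / \<epsilon> + 1"
      using x0 \<epsilon> by (auto simp: q_def lattice_side_def x_def) linarith+
    have "real K * 128 \<le> real K * R" using R128 by (intro mult_left_mono) auto
    then have "2 * real K \<le> x" using K8 x0 by linarith
    also have "x \<le> x / \<epsilon>" using x0 \<epsilon> by (simp add: field_simps)
    also have "\<dots> \<le> real q" by (rule q)
    finally have Kq: "2 * K \<le> q" by linarith
    have "real q * \<epsilon> \<le> (x / \<epsilon> + 1) * \<epsilon>" using q \<epsilon> by (intro mult_right_mono) auto
    also have "\<dots> \<le> x + 1" using \<epsilon> by (simp add: field_simps)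
    finally have "3 * (real q * \<epsilon>) \<le> 3 * (x + 1)" by simp
    also note K3
    finally have q\<epsilon>: "3 * (real q * \<epsilon>) \<le> real K * R" .
    \<comment> \<open>The summand 2 and the rounding cost at most 3, absorbed by
      \<open>1 \<le> x / R\<close>; hence 98307 = 98304 + 3.\<close>
    define T where "T = nat \<lceil>2 + 98304 * x / R\<rceil>"
    have T: "2 + 98304 * x / R \<le> real T" "real T \<le> 98307 * (x / R)"
    proof -
      have "0 \<le> 2 + 98304 * x / R" using x0 R0 by simp
      then have "real T \<le> 2 + 98304 * x / R + 1" unfolding T_def by linarith
      then show "real T \<le> 98307 * (x / R)" using xR by simp
      show "2 + 98304 * x / R \<le> real T" unfolding T_def by linarith
    qed
    have "1 \<le> ln R" using R128 by (intro ln3) simp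
    then have "0 \<le> ln (ln R)" by (rule ln_ge_zero)
    then have "real T \<le> 98307 * (x / R + ln (ln R))" using T(2) by simp
    then have TH: "T \<le> H" unfolding H x_def[symmetric] by (intro le_nat_floor)
    have "1 - real T * (real K)\<^sup>2 * (2 * exp (- (R\<^sup>2 / 4096)))
        \<le> measure_pmf.prob (meg_pmf n r \<epsilon> H) {P. flooding_time n R P \<le> enat H}"
      using n r \<epsilon>(1) Kpos Kq K3 K8 q\<epsilon> R0 T(1) TH
      by (intro prob_flooding_time_le) (auto simp: q_def x_def)
    moreover have "real T * (real K)\<^sup>2 * (2 * exp (- (R\<^sup>2 / 4096))) \<le> 1 / real n"
    proof -
      have "x / R \<le> x" using R128 x0 by (simp add: field_simps)
      also have "x \<le> x * x" using x0 xR R128 by (simp add: field_simps)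
      finally have T': "real T \<le> 98307 * real n" using T(2) x2 by linarith
      have "real K \<le> real K * R" using R128 by (simp add: mult_le_cancel_left1)
      then have "real K \<le> 8 * x" using K8 by linarith
      then have "(real K)\<^sup>2 \<le> (8 * x)\<^sup>2" by (intro power_mono) auto
      then have K': "(real K)\<^sup>2 \<le> 64 * real n" by (simp add: power2_eq_square flip: x2)
      \<comment> \<open>The constant 128 gives
        \<open>R\<^sup>2 / 4096 \<ge> 4 * ln (real n)\<close>, so each exponential is at most
        \<open>1 / real n ^ 4\<close>, against \<open>T * K\<^sup>2\<close> of order at most
        \<open>n\<^sup>2\<close>.\<close>
      have "(128 * sqrt (ln (real n)))\<^sup>2 \<le> R\<^sup>2" using R(1) ln1 by (intro power_mono) auto
      then have "16384 * ln (real n) \<le> R\<^sup>2" using ln1 by (simp add: power_mult_distrib)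
      then have "exp (- (R\<^sup>2 / 4096)) \<le> exp (- (4 * ln (real n)))" by simp
      also have "\<dots> = 1 / real n ^ 4"
        using n0 exp_of_nat_mult[of 4 "ln (real n)"] by (simp add: exp_minus divide_inverse)
      finally have E: "exp (- (R\<^sup>2 / 4096)) \<le> 1 / real n ^ 4" .
      \<comment> \<open>The product of constants 98307 * 64 * 2 = 12583296 is below the threshold
        20000000 on \<open>n\<close>.\<close>
      have "real T * (real K)\<^sup>2 * (2 * exp (- (R\<^sup>2 / 4096)))
          \<le> (98307 * real n) * (64 * real n) * (2 * (1 / real n ^ 4))"
        using T' K' E by (intro mult_mono) auto
      also have "\<dots> = 12583296 / real n / real n" using n0 by (simp add: power4_eq_xxxx field_simps)
      also have "\<dots> \<le> 1 / real n" using n by (intro divide_right_mono) (auto simp: field_simps)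
      finally show ?thesis .
    qed
    ultimately show ?thesis by linarith
  qed
  show ?thesis
    by (rule exI[of _ 128], rule exI[of _ 98307], intro conjI exI[of _ 20000000] allI impI)
      (unfold Let_def, auto intro: main)
qed

end
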